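(* Let $\eta_t=B\varepsilon_t$, where $B=(b_{\cdot1},\dots,b_{\cdot n})$ is an $n\times n$ matrix with entries $b_{ij}$, and $\varepsilon_t\in\mathbb{R}^n$ is a vector of structural shocks with $\mathbb{E}\varepsilon_t=0$ and $\mathbb{E}\varepsilon_t\varepsilon_t'=I_n$. Let $Z_t$ be a scalar random variable and $$\beta_Z=\mathbb{E}\big(\eta_t\eta_{1t}-\mathbb{E}\eta_t\eta_{1t}\big)\big(Z_t-\mathbb{E}Z_t\big)\in\mathbb{R}^n,$$ with first component $\beta_{Z1}$. Suppose that $\beta_{Z1}\neq0$ and that, for some $\rho_1\neq0$, $$\mathbb{E}\,\varepsilon_{it}\varepsilon_{jt}(Z_t-\mathbb{E}Z_t)=\rho_1\mathbf 1\{i=j=1\}\qquad\text{for all } i,j\in\{1,\dots,n\}.$$ Then the impact vector of the structural shock $\varepsilon_{1t}$ on $\eta_t$, normalized to have unit impact on the first series, is $\beta_Z/\beta_{Z1}$; that is, $b_{\cdot1}/b_{11}=\beta_Z/\beta_{Z1}$.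
   Context: $\eta_{1t}$ denotes the first component of $\eta_t$, and $\varepsilon_{it}$ the $i$-th component of $\varepsilon_t$. The impact vector of $\varepsilon_{1t}$ on $\eta_t$ is the first column $b_{\cdot1}$ of $B$; normalizing to a unit impact on series $1$ means dividing by $b_{11}$. All expectations appearing in the statement are assumed to exist and be finite. *)

theory Defs
  imports "HOL-Probability.Probability"
begin

text \<open>
  The coordinates \<open>1, \<dots>, n\<close> are the elements of a finite type \<open>'n\<close>, and the series (and shock)
  numbered 1 is a designated element of \<open>'n\<close>, passed as the argument \<open>k\<close> below.
\<close>

definition outer :: "real ^ 'n \<Rightarrow> real ^ 'n \<Rightarrow> real ^ 'n ^ 'n" where
  "outer x y = (\<chi> i j. x $ i * y $ j)"

definition proxy_beta ::
  "'a measure \<Rightarrow> 'n \<Rightarrow> ('a \<Rightarrow> real ^ 'n) \<Rightarrow> ('a \<Rightarrow> real) \<Rightarrow> real ^ 'n" where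
  "proxy_beta M k \<eta> Z =
     (LINT \<omega>|M. (Z \<omega> - (LINT \<omega>'|M. Z \<omega>')) *\<^sub>R
        ((\<eta> \<omega> $ k) *\<^sub>R \<eta> \<omega> - (LINT \<omega>'|M. (\<eta> \<omega>' $ k) *\<^sub>R \<eta> \<omega>')))"

end

theory Submission
  imports Defs
begin

text \<open>
  Expanding both factors of \<open>\<eta>\<^sub>l \<eta>\<^sub>1\<close> in the shocks, the proxy condition kills all terms
  but the one in \<open>\<epsilon>\<^sub>1\<^sup>2\<close>, and the centring of \<open>\<eta> \<eta>\<^sub>1\<close> is irrelevant because \<open>Z\<close> is already centred.
  Hence \<open>\<beta>\<^sub>Z = \<rho>\<^sub>1 b\<^sub>1\<^sub>1 b\<^sub>\<cdot>\<^sub>1\<close>, and \<open>\<beta>\<^sub>Z\<^sub>1 \<noteq> 0\<close> forces \<open>b\<^sub>1\<^sub>1 \<noteq> 0\<close>.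
\<close>

text \<open>Coordinate projections are bounded linear, so they commute with the Bochner integral;
  this reduces the vector-valued \<open>proxy_beta\<close> to scalar expectations.\<close>

lemma integral_vec_nth:
  fixes f :: "'a \<Rightarrow> real ^ 'n"
  assumes "integrable M f"
  shows "(LINT \<omega>|M. f \<omega>) $ i = (LINT \<omega>|M. f \<omega> $ i)"
  using integral_bounded_linear[OF bounded_linear_vec_nth[of i] assms] by simp

text \<open>The constant contributes \<open>c\<close> times the mean of a centred variable, which is
  0. Since \<open>c\<close> is arbitrary, a coordinate of a vector mean can be inserted as it
  stands.\<close>

lemma (in prob_space) covariance_center_right:
  fixes Y Z :: "'a \<Rightarrow> real"
  assumes Z: "integrable M Z"
    and YZ: "integrable M (\<lambda>\<omega>. Y \<omega> * (Z \<omega> - expectation Z))"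
  shows "expectation (\<lambda>\<omega>. (Z \<omega> - expectation Z) * (Y \<omega> - c)) =
    expectation (\<lambda>\<omega>. Y \<omega> * (Z \<omega> - expectation Z))"
proof -
  have "expectation (\<lambda>\<omega>. (Z \<omega> - expectation Z) * (Y \<omega> - c)) =
      expectation (\<lambda>\<omega>. Y \<omega> * (Z \<omega> - expectation Z) - c * (Z \<omega> - expectation Z))"
    by (simp add: algebra_simps)
  also have "\<dots> = expectation (\<lambda>\<omega>. Y \<omega> * (Z \<omega> - expectation Z)) -
      expectation (\<lambda>\<omega>. c * (Z \<omega> - expectation Z))"
    using Z by (intro Bochner_Integration.integral_diff YZ) simp
  also have "expectation (\<lambda>\<omega>. c * (Z \<omega> - expectation Z)) = 0"
    using Z by (simp add: prob_space)
  finally show ?thesis by simp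
qed

text \<open>Bilinearity, with the weight \<open>z\<close> moved inside so that each summand is a
  constant times an integrand of the proxy condition.\<close>

lemma matrix_vector_mult_nth_prod:
  fixes A :: "real ^ 'n ^ 'm"
  shows "(A *v x) $ k * (A *v x) $ l * z =
    (\<Sum>i\<in>UNIV. \<Sum>j\<in>UNIV. (A $ k $ i * A $ l $ j) * (x $ i * x $ j * z))"
  unfolding matrix_vector_mult_def vec_lambda_beta sum_product
  unfolding sum_distrib_right
  by (intro sum.cong refl) (simp add: mult_ac)

theorem theorem6:
  fixes M :: "'a measure"
    and B :: "real ^ 'n ^ 'n"
    and \<epsilon> \<eta> :: "'a \<Rightarrow> real ^ 'n"
    and Z :: "'a \<Rightarrow> real"
    and one :: 'n
    and \<rho>\<^sub>1 :: real
  assumes "prob_space M"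
    and \<eta>: "\<And>\<omega>. \<omega> \<in> space M \<Longrightarrow> \<eta> \<omega> = B *v \<epsilon> \<omega>"
    and int_\<epsilon>: "integrable M \<epsilon>"
    and mean_\<epsilon>: "(LINT \<omega>|M. \<epsilon> \<omega>) = 0"
    and int_\<epsilon>\<epsilon>: "integrable M (\<lambda>\<omega>. outer (\<epsilon> \<omega>) (\<epsilon> \<omega>))"
    and cov_\<epsilon>: "(LINT \<omega>|M. outer (\<epsilon> \<omega>) (\<epsilon> \<omega>)) = mat 1"
    and int_Z: "integrable M Z"
    and int_\<eta>\<eta>: "integrable M (\<lambda>\<omega>. (\<eta> \<omega> $ one) *\<^sub>R \<eta> \<omega>)"
    and int_\<beta>: "integrable M (\<lambda>\<omega>. (Z \<omega> - (LINT \<omega>'|M. Z \<omega>')) *\<^sub>R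
      ((\<eta> \<omega> $ one) *\<^sub>R \<eta> \<omega> - (LINT \<omega>'|M. (\<eta> \<omega>' $ one) *\<^sub>R \<eta> \<omega>')))"
    and \<beta>_nz: "proxy_beta M one \<eta> Z $ one \<noteq> 0"
    and \<rho>_nz: "\<rho>\<^sub>1 \<noteq> 0"
    and int_\<epsilon>\<epsilon>Z: "\<And>i j. integrable M (\<lambda>\<omega>. \<epsilon> \<omega> $ i * \<epsilon> \<omega> $ j * (Z \<omega> - (LINT \<omega>'|M. Z \<omega>')))"
    and proxy: "\<And>i j. (LINT \<omega>|M. \<epsilon> \<omega> $ i * \<epsilon> \<omega> $ j * (Z \<omega> - (LINT \<omega>'|M. Z \<omega>'))) =
      (if i = one \<and> j = one then \<rho>\<^sub>1 else 0)"
  shows "B $ one $ one \<noteq> 0 \<and>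
    column one B /\<^sub>R (B $ one $ one) =
      proxy_beta M one \<eta> Z /\<^sub>R (proxy_beta M one \<eta> Z $ one)"
proof -
  interpret prob_space M by fact
  define z where "z \<omega> = Z \<omega> - expectation Z" for \<omega>
  let ?\<beta> = "proxy_beta M one \<eta> Z"
  let ?S = "\<lambda>l \<omega>. \<Sum>i\<in>UNIV. \<Sum>j\<in>UNIV. (B $ one $ i * B $ l $ j) * (\<epsilon> \<omega> $ i * \<epsilon> \<omega> $ j * z \<omega>)"
  have \<epsilon>\<epsilon>z: "integrable M (\<lambda>\<omega>. \<epsilon> \<omega> $ i * \<epsilon> \<omega> $ j * z \<omega>)" for i j
    using int_\<epsilon>\<epsilon>Z[of i j] by (simp add: z_def)
  \<comment> \<open>The indicator is split into nested conditionals so that the sums over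
    \<open>j\<close> and then \<open>i\<close> collapse one after the other.\<close>
  have E\<epsilon>\<epsilon>z: "expectation (\<lambda>\<omega>. \<epsilon> \<omega> $ i * \<epsilon> \<omega> $ j * z \<omega>) =
      (if i = one then if j = one then \<rho>\<^sub>1 else 0 else 0)" for i j
    using proxy[of i j] by (simp add: z_def)
  \<comment> \<open>The model equation is available on \<open>space M\<close> only, so this
    expansion enters the integrals through congruence rules.\<close>
  have S: "\<eta> \<omega> $ one * \<eta> \<omega> $ l * z \<omega> = ?S l \<omega>" if "\<omega> \<in> space M" for \<omega> l
    using \<eta>[OF that] by (simp only: matrix_vector_mult_nth_prod)
  have int_\<eta>\<eta>z: "integrable M (\<lambda>\<omega>. \<eta> \<omega> $ one * \<eta> \<omega> $ l * z \<omega>)" for l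
  proof -
    have "integrable M (?S l)"
      by (intro Bochner_Integration.integrable_sum integrable_mult_right \<epsilon>\<epsilon>z)
    then show ?thesis
      by (simp add: S cong: Bochner_Integration.integrable_cong)
  qed
  have E\<eta>\<eta>z: "expectation (\<lambda>\<omega>. \<eta> \<omega> $ one * \<eta> \<omega> $ l * z \<omega>) =
      B $ one $ one * B $ l $ one * \<rho>\<^sub>1" for l
  proof -
    have "expectation (\<lambda>\<omega>. \<eta> \<omega> $ one * \<eta> \<omega> $ l * z \<omega>) = expectation (?S l)"
      by (rule Bochner_Integration.integral_cong[OF refl S])
    also have "\<dots> = (\<Sum>i\<in>UNIV. \<Sum>j\<in>UNIV. (B $ one $ i * B $ l $ j) *
        expectation (\<lambda>\<omega>. \<epsilon> \<omega> $ i * \<epsilon> \<omega> $ j * z \<omega>))"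
      by (simp only: Bochner_Integration.integral_sum Bochner_Integration.integrable_sum
          integrable_mult_right integral_mult_right_zero \<epsilon>\<epsilon>z)
    also have "\<dots> = (\<Sum>i\<in>UNIV. if i = one then B $ one $ one * B $ l $ one * \<rho>\<^sub>1 else 0)"
      by (intro sum.cong refl) (simp add: E\<epsilon>\<epsilon>z if_distrib[of "(*) _"] cong: if_cong)
    finally show ?thesis by simp
  qed
  have \<beta>: "?\<beta> $ l = \<rho>\<^sub>1 * B $ one $ one * B $ l $ one" for l
  proof -
    have "?\<beta> $ l = expectation (\<lambda>\<omega>. (Z \<omega> - expectation Z) *
        (\<eta> \<omega> $ one * \<eta> \<omega> $ l - expectation (\<lambda>\<omega>. (\<eta> \<omega> $ one) *\<^sub>R \<eta> \<omega>) $ l))"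
      unfolding proxy_beta_def by (simp add: integral_vec_nth[OF int_\<beta>])
    \<comment> \<open>The centring lemma applies with \<open>c\<close> the \<open>l\<close>-th
      coordinate of the mean of
      \<open>(\<eta> \<omega> $ one) *\<^sub>R \<eta> \<omega>\<close>.\<close>
    also have "\<dots> = expectation (\<lambda>\<omega>. \<eta> \<omega> $ one * \<eta> \<omega> $ l * z \<omega>)"
      using covariance_center_right[OF int_Z int_\<eta>\<eta>z[unfolded z_def]] by (simp add: z_def)
    finally show ?thesis by (simp add: E\<eta>\<eta>z)
  qed
  \<comment> \<open>At \<open>l = one\<close> the formula reads \<open>\<rho>\<^sub>1\<close> times
    the square of \<open>B $ one $ one\<close>.\<close>
  have "B $ one $ one \<noteq> 0"
    using \<beta>_nz by (auto simp: \<beta>)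
  \<comment> \<open>The common factor \<open>\<rho>\<^sub>1 * B $ one $ one\<close> is nonzero and
    cancels in each coordinate of the normalized vector.\<close>
  then show ?thesis
    using \<rho>_nz by (simp add: vec_eq_iff \<beta> column_def field_simps)
qed

end
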